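(* Let $W=\{z\in\mathbb{C}:\operatorname{Im}z>0\}\cup\mathbb{Q}$ be the union of the upper half plane with the rationals of the real line. There exists no $W$-bipartite universal function.
   Context: Here $d=1$, $U$ is the upper half plane, $T=\mathbb{Q}\subset\partial U=\mathbb{R}$ and $W=U\cup T$. Fix an enumeration $(N_j)_{j\ge 0}$ of $\mathbb{N}=\{0,1,2,\dots\}$. For $f$ holomorphic on $U$ and $\zeta\in\overline{U}$ to which all derivatives of $f$ extend continuously, $S_N(f,\zeta)(z)=\sum_{j=0}^N\frac{f^{(N_j)}(\zeta)}{N_j!}(z-\zeta)^{N_j}$ (values of the continuous extensions at boundary points). For $K\subset\mathbb{C}$ compact, $A_D(K)$ is the set of continuous $h:K\to\mathbb{C}$ such that for every open disc $D\subset\mathbb{C}$ and every holomorphic $\phi:D\to\mathbb{C}$ with $\phi(D)\subset K$, $h\circ\phi$ is holomorphic on $D$. $f$ is $W$-bipartite universal if (i) $f$ is holomorphic on $U$ and every derivative $f^{(k)}$, $k\ge0$, is continuously extendable on $W$; (ii) for every compact $L\subseteq W$, every compact $K\subseteq\mathbb{C}\setminus W$ with $\mathbb{C}\setminus K$ connected, and every $h\in A_D(K)$, there exists a sequence $\lambda_n\in\mathbb{N}$ such that $\sup_{z\in K,\zeta\in L}|S_{\lambda_n}(f,\zeta)(z)-h(z)|\to0$ and, for every $k\ge0$, $\sup_{z\in L,\zeta\in L}|(S_{\lambda_n}(f,\zeta))^{(k)}(z)-f^{(k)}(z)|\to0$. *)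

theory Defs
  imports "HOL-Complex_Analysis.Complex_Analysis"
begin

definition continuously_extendable_on ::
  "complex set \<Rightarrow> complex set \<Rightarrow> (complex \<Rightarrow> complex) \<Rightarrow> bool"
  where "continuously_extendable_on U W g \<longleftrightarrow>
    (\<exists>G. continuous_on W G \<and> (\<forall>z\<in>U. G z = g z))"

(* The value at z of the continuous extension of the k-th derivative of f from the open set U.
   At points of U this is the derivative itself; at a boundary point it is the limit from
   inside U, and it is meaningful only if that limit exists. *)
definition deriv_ext :: "complex set \<Rightarrow> (complex \<Rightarrow> complex) \<Rightarrow> nat \<Rightarrow> complex \<Rightarrow> complex"
  where "deriv_ext U f k z = Lim (at z within U) ((deriv ^^ k) f)"

(* Ns is the enumeration j |-> N_j of the natural numbers that orders the Taylor monomials. *)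
definition taylor_sum ::
  "(nat \<Rightarrow> nat) \<Rightarrow> complex set \<Rightarrow> nat \<Rightarrow> (complex \<Rightarrow> complex) \<Rightarrow> complex \<Rightarrow> complex \<Rightarrow> complex"
  where "taylor_sum Ns U N f \<zeta> z =
    (\<Sum>j=0..N. deriv_ext U f (Ns j) \<zeta> / fact (Ns j) * (z - \<zeta>) ^ Ns j)"

definition A_D :: "complex set \<Rightarrow> (complex \<Rightarrow> complex) set"
  where "A_D K = {h. continuous_on K h \<and>
    (\<forall>c r \<phi>. 0 < r \<longrightarrow> \<phi> holomorphic_on ball c r \<longrightarrow> \<phi> ` ball c r \<subseteq> K \<longrightarrow>
       (h \<circ> \<phi>) holomorphic_on ball c r)}"

(* Convergence to 0 of a supremum over a product set is expressed as uniform convergence on it. *)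
definition bipartite_universal ::
  "(nat \<Rightarrow> nat) \<Rightarrow> complex set \<Rightarrow> complex set \<Rightarrow> (complex \<Rightarrow> complex) \<Rightarrow> bool"
  where "bipartite_universal Ns U W f \<longleftrightarrow>
    f holomorphic_on U \<and>
    (\<forall>k. continuously_extendable_on U W ((deriv ^^ k) f)) \<and>
    (\<forall>L K h. compact L \<longrightarrow> L \<subseteq> W \<longrightarrow> compact K \<longrightarrow> K \<subseteq> - W \<longrightarrow> connected (- K) \<longrightarrow> h \<in> A_D K \<longrightarrow>
      (\<exists>ls :: nat \<Rightarrow> nat.
         uniform_limit (K \<times> L) (\<lambda>n (z, \<zeta>). taylor_sum Ns U (ls n) f \<zeta> z)
           (\<lambda>(z, \<zeta>). h z) sequentially \<and>
         (\<forall>k. uniform_limit (L \<times> L)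
           (\<lambda>n (z, \<zeta>). (deriv ^^ k) (taylor_sum Ns U (ls n) f \<zeta>) z)
           (\<lambda>(z, \<zeta>). deriv_ext U f k z) sequentially)))"

end

theory Submission
  imports Defs
begin

text \<open>Since the extension of \<open>f''\<close> is continuous at the rational point \<open>0\<close>, \<open>f''\<close> is bounded on a half disc
  around \<open>0\<close>. Take a disc of radius \<open>y\<close> and centre \<open>\<zeta>\<close> inside this half disc, tangent to the real line at
  an irrational \<open>x\<close>. Cauchy's estimates for \<open>f''\<close> show that the Taylor coefficients \<open>a\<^sub>j\<close> of \<open>f\<close> at \<open>\<zeta>\<close>
  satisfy \<open>\<bar>a\<^sub>j\<bar> y\<^sup>j = O(1 / j\<^sup>2)\<close>. So the Taylor series converges absolutely at \<open>x\<close>, and its partial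
  sums there, in whatever order, cannot approach a large constant on \<open>K = {x}\<close>.\<close>

text \<open>Cauchy's inequality on circles of radius \<open>s < r\<close>, then
  \<open>s \<rightarrow> r\<close>. Nothing is assumed on the boundary circle, which in the
  application contains the irrational point of tangency.\<close>

lemma Cauchy_estimate_open_ball:
  fixes f :: "complex \<Rightarrow> complex"
  assumes holf: "f holomorphic_on ball z r" and "0 < r"
    and bound: "\<And>w. w \<in> ball z r \<Longrightarrow> norm (f w) \<le> B"
  shows "norm ((deriv ^^ n) f z) * r ^ n \<le> fact n * B"
proof (rule tendsto_upperbound)
  show "((\<lambda>s. norm ((deriv ^^ n) f z) * s ^ n) \<longlongrightarrow> norm ((deriv ^^ n) f z) * r ^ n) (at_left r)"
    by (intro tendsto_intros)
  have "norm ((deriv ^^ n) f z) * s ^ n \<le> fact n * B" if s: "0 < s" "s < r" for s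
  proof -
    have "norm ((deriv ^^ n) f z) \<le> fact n * B / s ^ n"
    proof (rule Cauchy_inequality)
      show "f holomorphic_on ball z s"
        using holf s by (auto intro: holomorphic_on_subset)
      show "continuous_on (cball z s) f"
        using s by (intro holomorphic_on_imp_continuous_on holomorphic_on_subset[OF holf]) auto
      show "norm (f w) \<le> B" if "norm (z - w) = s" for w
        using bound s that by (simp add: dist_norm)
    qed (use s in auto)
    then show ?thesis
      using s by (simp add: field_simps)
  qed
  then show "\<forall>\<^sub>F s in at_left r. norm ((deriv ^^ n) f z) * s ^ n \<le> fact n * B"
    using eventually_at_left_real[OF \<open>0 < r\<close>] by (auto elim!: eventually_mono)
qed simp

text \<open>Cauchy's estimate for \<open>f''\<close> gains the factor
  \<open>1 / ((j + 1) * (j + 2))\<close> in the term of index \<open>j + 2\<close>. A bound on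
  \<open>f'\<close> would by the same estimate give only \<open>1 / (j + 1)\<close>, which is not
  summable.\<close>

lemma summable_Taylor_coefficients_if_bounded_deriv2:
  fixes f :: "complex \<Rightarrow> complex"
  assumes holf: "f holomorphic_on ball z r" and r: "0 < r"
    and bound: "\<And>w. w \<in> ball z r \<Longrightarrow> norm ((deriv ^^ 2) f w) \<le> B"
  shows "summable (\<lambda>j. norm ((deriv ^^ j) f z) / fact j * r ^ j)" (is "summable ?b")
proof -
  have "0 \<le> B"
    using bound[of z] r by (smt (verit) centre_in_ball norm_ge_zero)
  have term_le: "norm (?b (j + 2)) \<le> B * r\<^sup>2 * inverse (real (Suc j) ^ 2)" for j
  proof -
    have "norm ((deriv ^^ j) ((deriv ^^ 2) f) z) * r ^ j \<le> fact j * B"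
      by (intro Cauchy_estimate_open_ball holomorphic_higher_deriv holf r bound open_ball)
    then have "norm ((deriv ^^ (j + 2)) f z) * r ^ j \<le> fact j * B"
      by (simp only: funpow_add o_apply)
    then have "norm ((deriv ^^ (j + 2)) f z) * r ^ j * r\<^sup>2 \<le> fact j * B * r\<^sup>2"
      by (intro mult_right_mono) auto
    then have "?b (j + 2) \<le> fact j * B * r\<^sup>2 / fact (j + 2)"
      by (simp only: power_add times_divide_eq_left mult.assoc) (erule divide_right_mono, simp)
    also have "\<dots> = B * r\<^sup>2 * inverse (real (Suc j) * real (j + 2))"
    proof -
      have "fact (j + 2) = fact j * (real (Suc j) * real (j + 2))"
        by (simp add: algebra_simps)
      then show ?thesis
        by (simp only:) (simp add: divide_inverse)
    qed
    also have "\<dots> \<le> B * r\<^sup>2 * inverse (real (Suc j) ^ 2)"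
      using \<open>0 \<le> B\<close>
      by (intro mult_left_mono le_imp_inverse_le) (auto simp: power2_eq_square)
    finally show ?thesis
      using r by simp
  qed
  have "summable (\<lambda>j. B * r\<^sup>2 * inverse (real (Suc j) ^ 2))"
    by (intro summable_mult) (subst summable_Suc_iff, simp add: inverse_power_summable)
  then have "summable (\<lambda>j. ?b (j + 2))"
    by (rule summable_comparison_test'[where N = 0]) (rule term_le)
  then show ?thesis
    by (rule summable_iff_shift[of ?b 2, THEN iffD1])
qed

lemma deriv_ext_eq_deriv:
  assumes "f holomorphic_on U" "open U" "z \<in> U"
  shows "deriv_ext U f k z = (deriv ^^ k) f z"
proof -
  have "(deriv ^^ k) f holomorphic_on U"
    using assms by (intro holomorphic_higher_deriv)
  then have "((deriv ^^ k) f \<longlongrightarrow> (deriv ^^ k) f z) (at z within U)"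
    using assms holomorphic_on_imp_continuous_on by (metis continuous_on_def)
  then show ?thesis
    unfolding deriv_ext_def
    \<comment> \<open>\<open>Lim\<close> is determined only along a nontrivial filter; openness of
      \<open>U\<close> turns \<open>at z within U\<close> into \<open>at z\<close>.\<close>
    by (rule tendsto_Lim[rotated]) (simp add: at_within_open[OF assms(3,2)])
qed

text \<open>Injectivity of \<open>Ns\<close> makes the summands distinct terms of one nonnegative
  series, so the bound depends neither on \<open>N\<close> nor on the order of summation.\<close>

lemma norm_taylor_sum_le_suminf:
  assumes "f holomorphic_on U" "open U" "z \<in> U" "inj Ns"
    and summable: "summable (\<lambda>j. norm ((deriv ^^ j) f z) / fact j * norm (w - z) ^ j)"
  shows "norm (taylor_sum Ns U N f z w) \<le> (\<Sum>j. norm ((deriv ^^ j) f z) / fact j * norm (w - z) ^ j)"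
    (is "_ \<le> suminf ?b")
proof -
  have "norm (taylor_sum Ns U N f z w) \<le> (\<Sum>j=0..N. ?b (Ns j))"
    unfolding taylor_sum_def
    by (rule order_trans[OF norm_sum])
      (simp add: deriv_ext_eq_deriv[OF assms(1-3)] norm_mult norm_divide norm_power)
  also have "\<dots> = sum ?b (Ns ` {0..N})"
    using \<open>inj Ns\<close> by (simp add: sum.reindex inj_on_subset)
  also have "\<dots> \<le> suminf ?b"
    by (intro sum_le_suminf summable) auto
  finally show ?thesis .
qed

lemma ex_irrational_between:
  fixes a b :: real
  assumes "a < b"
  shows "\<exists>x. a < x \<and> x < b \<and> x \<notin> \<rat>"
proof -
  have "uncountable ({a<..<b} - \<rat>)"
    using assms by (intro uncountable_minus_countable uncountable_open_interval[THEN iffD2] countable_rat)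
  then show ?thesis
    by (metis DiffE countable_empty equals0I greaterThanLessThan_iff)
qed

text \<open>Universality for the singletons \<open>K = {z}\<close> and \<open>L = {\<zeta>}\<close>:
  the complement of a point is connected, and constants lie in \<open>A_D {z}\<close>.\<close>

lemma bipartite_universal_pointwise:
  assumes univ: "bipartite_universal Ns U W f" and "\<zeta> \<in> W" "z \<notin> W"
  shows "\<exists>ls. (\<lambda>n. taylor_sum Ns U (ls n) f \<zeta> z) \<longlonglongrightarrow> c"
proof -
  have "(\<lambda>_. c) \<in> A_D {z}"
    by (auto simp: A_D_def o_def)
  then obtain ls where "uniform_limit ({z} \<times> {\<zeta>})
      (\<lambda>n (z, \<zeta>). taylor_sum Ns U (ls n) f \<zeta> z) (\<lambda>(z, \<zeta>). c) sequentially"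
    using univ[unfolded bipartite_universal_def, THEN conjunct2, THEN conjunct2, rule_format,
        of "{\<zeta>}" "{z}" "\<lambda>_. c"] assms
    by (auto simp: connected_punctured_universe)
  then have "((\<lambda>n. (\<lambda>(z, \<zeta>). taylor_sum Ns U (ls n) f \<zeta> z) (z, \<zeta>)) \<longlongrightarrow> (\<lambda>(z, \<zeta>). c) (z, \<zeta>)) sequentially"
    by (rule tendsto_uniform_limitI) simp
  then show ?thesis
    by auto
qed

theorem corollary4p8:
  fixes Ns :: "nat \<Rightarrow> nat" and U W :: "complex set"
  assumes "bij Ns"
    and "U = {z. Im z > 0}"
    and "W = U \<union> complex_of_real ` \<rat>"
  shows "\<not> (\<exists>f. bipartite_universal Ns U W f)"
proof
  assume "\<exists>f. bipartite_universal Ns U W f"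
  then obtain f where univ: "bipartite_universal Ns U W f" ..
  then have holf: "f holomorphic_on U"
    by (simp add: bipartite_universal_def)
  have "open U"
    unfolding assms(2) by (rule open_halfspace_Im_gt)
  have "continuously_extendable_on U W ((deriv ^^ 2) f)"
    using univ unfolding bipartite_universal_def by (elim conjE allE)
  then obtain G where "continuous_on W G" and G: "\<And>z. z \<in> U \<Longrightarrow> G z = (deriv ^^ 2) f z"
    unfolding continuously_extendable_on_def by metis
  moreover have "0 \<in> W"
    unfolding assms(3) by (intro UnI2 image_eqI[of _ _ 0]) simp_all
  ultimately obtain d where "d > 0" and d: "\<And>z. z \<in> W \<Longrightarrow> dist z 0 < d \<Longrightarrow> dist (G z) (G 0) < 1"
    unfolding continuous_on_iff by (meson zero_less_one)
  have bound: "norm ((deriv ^^ 2) f z) \<le> norm (G 0) + 1" if "z \<in> U" "norm z < d" for z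
  proof -
    have "dist (G z) (G 0) < 1"
      using d that assms(3) by simp
    then show ?thesis
      using G[OF \<open>z \<in> U\<close>] norm_triangle_sub[of "G z" "G 0"] by (simp add: dist_norm)
  qed
  \<comment> \<open>The thirds keep the tangent disc within distance \<open>d\<close> of
    \<open>0\<close>: its points have norm below \<open>y + y + x < d\<close>.\<close>
  obtain x where x: "0 < x" "x < d / 3" "x \<notin> \<rat>"
    using ex_irrational_between[of 0 "d / 3"] \<open>d > 0\<close> by auto
  define y where "y = d / 3"
  define \<zeta> where "\<zeta> = Complex x y"
  have "y > 0"
    using \<open>d > 0\<close> by (simp add: y_def)
  have "\<zeta> \<in> U"
    using \<open>y > 0\<close> by (simp add: \<zeta>_def assms(2))
  have y: "norm (complex_of_real x - \<zeta>) = y"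
    using \<open>y > 0\<close> by (simp add: \<zeta>_def norm_complex_def)
  have ball: "z \<in> U" "norm z < d" if "z \<in> ball \<zeta> y" for z
  proof -
    have "norm (z - \<zeta>) < y"
      using that by (simp add: dist_norm norm_minus_commute)
    moreover have "\<bar>Im (z - \<zeta>)\<bar> \<le> norm (z - \<zeta>)"
      by (rule abs_Im_le_cmod)
    ultimately show "z \<in> U"
      by (simp add: assms(2) \<zeta>_def)
    have "norm z \<le> norm (z - \<zeta>) + norm (complex_of_real x - \<zeta>) + norm (complex_of_real x)"
      by norm
    then show "norm z < d"
      using \<open>norm (z - \<zeta>) < y\<close> y x by (simp add: y_def)
  qed
  have "summable (\<lambda>j. norm ((deriv ^^ j) f \<zeta>) / fact j * y ^ j)"
    using ball bound \<open>y > 0\<close>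
    by (intro summable_Taylor_coefficients_if_bounded_deriv2 holomorphic_on_subset[OF holf]) auto
  \<comment> \<open>\<open>A\<close> is the sum of the absolute series at distance \<open>y\<close>
    from \<open>\<zeta>\<close>, the same for all \<open>N\<close>.\<close>
  then obtain A where A: "\<And>N. norm (taylor_sum Ns U N f \<zeta> (complex_of_real x)) \<le> A"
    using norm_taylor_sum_le_suminf[OF holf \<open>open U\<close> \<open>\<zeta> \<in> U\<close> bij_is_inj[OF assms(1)],
        of "complex_of_real x"]
    unfolding y by blast
  \<comment> \<open>Any constant of modulus above \<open>A\<close> is out of reach of the partial
    sums at \<open>x\<close>.\<close>
  define c where "c = complex_of_real (A + 1)"
  have "complex_of_real x \<notin> W"
    using x by (auto simp: assms(2,3))
  then obtain ls where "(\<lambda>n. taylor_sum Ns U (ls n) f \<zeta> (complex_of_real x)) \<longlonglongrightarrow> c"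
    using bipartite_universal_pointwise[OF univ] \<open>\<zeta> \<in> U\<close> assms(3) by (metis UnI1)
  then have "norm c \<le> A"
    using A by (intro Lim_norm_ubound[OF sequentially_bot]) auto
  then show False
    by (simp add: c_def)
qed

end
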